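(* Let $X$ be an infinite-dimensional complex Banach space and let $T\in\mathcal{B}(X)$. The following statements are equivalent: (i) $T$ is right Drazin invertible. (ii) $d(T)<\infty$ and $\mathcal{N}(T^n)$ and $\mathcal{R}(T^n)$ are topologically complemented for every $n\ge d(T)$. (iii) $d(T)<\infty$ and there exists $n\ge d(T)$ such that $\mathcal{N}(T^{n+1})$ and $\mathcal{R}(T^n)$ are topologically complemented.
   Context: $\mathcal{B}(X)$ is the algebra of bounded linear operators on $X$; $\mathcal{N}(T)$, $\mathcal{R}(T)$ denote kernel and range. A subspace of $X$ is topologically complemented if it is closed and has a closed algebraic complement in $X$. The descent $d(T)$ is the smallest $n\in\{0,1,2,\dots\}$ with $\mathcal{R}(T^n)=\mathcal{R}(T^{n+1})$ ($\infty$ if there is none). $T$ is right Drazin invertible if $q:=d(T)<\infty$ and $\mathcal{N}(T)\cap\mathcal{R}(T^q)$ is topologically complemented in $X$. *)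

theory Defs
  imports "HOL-Analysis.Analysis" "HOL-Library.Extended_Nat"
begin

text \<open>
  HOL-Analysis has only real normed spaces. A complex normed space is a real normed space with
  a complex scalar multiplication that extends \<open>scaleR\<close> and is compatible with the norm.
\<close>

class scaleC = scaleR +
  fixes scaleC :: "complex \<Rightarrow> 'a \<Rightarrow> 'a"  (infixr \<open>*\<^sub>C\<close> 75)
  assumes scaleR_scaleC: "r *\<^sub>R x = complex_of_real r *\<^sub>C x"

class complex_vector = scaleC + ab_group_add +
  assumes scaleC_add_right: "a *\<^sub>C (x + y) = a *\<^sub>C x + a *\<^sub>C y"
    and scaleC_add_left: "(a + b) *\<^sub>C x = a *\<^sub>C x + b *\<^sub>C x"
    and scaleC_scaleC: "a *\<^sub>C b *\<^sub>C x = (a * b) *\<^sub>C x"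
    and scaleC_one: "1 *\<^sub>C x = x"

class complex_normed_vector = complex_vector + real_normed_vector +
  assumes norm_scaleC: "norm (a *\<^sub>C x) = cmod a * norm x"

class cbanach = complex_normed_vector + complete_space

subclass (in cbanach) banach ..

global_interpretation complex_vector: vector_space "scaleC :: complex \<Rightarrow> 'a \<Rightarrow> 'a::complex_vector"
  defines csubspace = complex_vector.subspace
    and cspan = complex_vector.span
  by standard (simp_all add: scaleC_add_right scaleC_add_left scaleC_scaleC scaleC_one)

instantiation complex :: cbanach
begin
definition scaleC_complex :: "complex \<Rightarrow> complex \<Rightarrow> complex"
  where "scaleC_complex a x = a * x"
instance
  by standard (simp_all add: scaleC_complex_def scaleR_conv_of_real algebra_simps norm_mult)
end

definition infinite_dimensional :: "'a::complex_vector itself \<Rightarrow> bool"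
  where "infinite_dimensional _ \<longleftrightarrow> \<not> (\<exists>B :: 'a set. finite B \<and> cspan B = UNIV)"

locale bounded_clinear = Vector_Spaces.linear scaleC scaleC f
  for f :: "'a::complex_normed_vector \<Rightarrow> 'b::complex_normed_vector" +
  assumes bounded: "\<exists>K. \<forall>x. norm (f x) \<le> norm x * K"

definition null_space :: "('a \<Rightarrow> 'b::zero) \<Rightarrow> 'a set"
  where "null_space f = {x. f x = 0}"

definition top_complemented :: "'a::complex_normed_vector set \<Rightarrow> bool"
  where "top_complemented M \<longleftrightarrow> csubspace M \<and> closed M \<and>
    (\<exists>N. csubspace N \<and> closed N \<and> M \<inter> N = {0} \<and> {x + y | x y. x \<in> M \<and> y \<in> N} = UNIV)"

definition descent :: "('a \<Rightarrow> 'a) \<Rightarrow> enat"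
  where "descent T =
    (if \<exists>n. range (T ^^ n) = range (T ^^ (n + 1))
     then enat (LEAST n. range (T ^^ n) = range (T ^^ (n + 1))) else \<infinity>)"

definition right_Drazin_invertible :: "('a::complex_normed_vector \<Rightarrow> 'a) \<Rightarrow> bool"
  where "right_Drazin_invertible T \<longleftrightarrow>
    (\<exists>q. descent T = enat q \<and> top_complemented (null_space T \<inter> range (T ^^ q)))"

end

theory Submission
  imports Defs
begin

text \<open>
  Let \<open>q\<close> be the descent of \<open>T\<close> and \<open>R = range (T ^^ q)\<close>, so that \<open>T\<close> maps \<open>R\<close> onto \<open>R\<close>. On a Banach
  space a set is topologically complemented iff it is the range of a bounded projection
  (\<open>top_complemented_imp_projection\<close>, \<open>projection_imp_top_complemented\<close>), so every implication
  amounts to building one bounded projection from others.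

  The subspace \<open>R\<close> need not be closed a priori, but it is the range of a bounded operator, and the
  open mapping theorem still controls preimages. In the form \<open>factor_through_range\<close> it says: if
  \<open>range A \<subseteq> range G\<close> and \<open>H\<close> vanishes on the kernel of \<open>G\<close>, then sending \<open>x\<close> to \<open>H z\<close>, for any
  solution \<open>z\<close> of \<open>G z = A x\<close>, is a bounded operator.

  Suppose that \<open>P\<close> is a bounded projection onto the intersection of the kernel of \<open>T\<close> with \<open>R\<close>. Then
  the restriction of \<open>T\<close> to \<open>R\<close> has a linear right inverse with values in \<open>R\<close>, namely the one that
  selects the preimages in the kernel of \<open>P\<close>. Whether or not it is bounded in the norm of the whole
  space, its composition with any bounded operator into \<open>R\<close> is bounded (\<open>lift_along_range\<close>). Hence
  for \<open>n \<ge> q\<close> the operator \<open>T ^^ n\<close> lifts to a bounded \<open>E\<close> into \<open>R\<close> with \<open>T ^^ n \<circ> E = T ^^ n\<close>, and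
  \<open>I - E\<close> projects onto the kernel of \<open>T ^^ n\<close>. The same lifts give a bounded projection \<open>Q\<close> onto the
  part of this kernel in \<open>R\<close> (\<open>projection_null_funpow_range\<close>). As \<open>E\<close> maps into \<open>R\<close>, each point
  of \<open>R\<close> is its image under \<open>E\<close> plus a kernel vector in \<open>R\<close>, so \<open>E + Q (I - E)\<close> projects
  onto \<open>R\<close>.

  Conversely, if \<open>F\<close> projects onto \<open>R = range (T ^^ n)\<close> and \<open>P\<close> projects onto the kernel of
  \<open>T ^^ (n + 1)\<close>, let \<open>B x = (T ^^ n) (z - P z)\<close> where \<open>(T ^^ (n + 1)) z = T (F x)\<close>. Then \<open>B\<close> is bounded
  with values in \<open>R\<close> and \<open>T \<circ> B = T \<circ> F\<close>, and \<open>F - B\<close> projects onto the intersection of the kernel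
  of \<open>T\<close> with \<open>R\<close>.
\<close>

section \<open>The open mapping theorem for closed linear relations\<close>

text \<open>
  The Baire category half of the open mapping theorem. The sets of points that have a preimage of
  norm at most \<open>n\<close> cover the space, so the closure of one of them contains a ball; subtracting its
  centre and rescaling gives approximate preimages of every point, with a uniform bound.
\<close>

lemma closed_relation_approx:
  fixes W :: "('a::banach \<times> 'b::banach) set"
  assumes W: "subspace W" and surj: "\<And>x. \<exists>z. (z, x) \<in> W"
  shows "\<exists>K\<ge>0. \<forall>x. \<forall>e>0. \<exists>z y. (z, y) \<in> W \<and> norm z \<le> K * norm x \<and> norm (x - y) < e"
proof -
  define A where "A n = {x. \<exists>z. (z, x) \<in> W \<and> norm z \<le> real n}" for n
  have "(\<Union>n. closure (A n)) = UNIV"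
  proof -
    have "x \<in> (\<Union>n. closure (A n))" for x
    proof -
      obtain z where "(z, x) \<in> W" using surj by blast
      moreover obtain n where "norm z \<le> real n" using real_arch_simple by blast
      ultimately have "x \<in> A n" unfolding A_def by blast
      then show ?thesis using closure_subset by blast
    qed
    then show ?thesis by blast
  qed
  moreover have "euclidean interior_of (\<Union>n. closure (A n)) = {}"
    if "\<And>n. interior (closure (A n)) = {}"
    by (rule Baire_category_alt)
       (use that in \<open>auto simp: completely_metrizable_space_euclidean\<close>)
  ultimately obtain n where "interior (closure (A n)) \<noteq> {}" by fastforce
  then obtain x0 r where r: "r > 0" "ball x0 r \<subseteq> closure (A n)"
    by (metis all_not_in_conv mem_interior)
  \<comment> \<open>The factor 4: two preimages of norm at most \<open>n\<close> are subtracted, and \<open>x\<close> is rescaled to length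
    \<open>r / 2\<close> to stay inside the ball.\<close>
  show ?thesis
  proof (intro exI[of _ "4 * real n / r"] conjI allI impI)
    show "4 * real n / r \<ge> 0" using r by simp
  next
    fix x :: 'b and e :: real assume e: "e > 0"
    show "\<exists>z y. (z, y) \<in> W \<and> norm z \<le> 4 * real n / r * norm x \<and> norm (x - y) < e"
    proof (cases "x = 0")
      case True
      then show ?thesis using e subspace_0[OF W]
        by (intro exI[of _ 0]) (simp add: zero_prod_def)
    next
      case False
      define s where "s = r / (2 * norm x)"
      have s: "s > 0" using False r by (simp add: s_def)
      have "x0 \<in> closure (A n)" "x0 + s *\<^sub>R x \<in> closure (A n)"
        using r False by (auto intro!: subsetD[OF r(2)] simp: dist_norm s_def)
      then obtain y1 y2 where y: "y1 \<in> A n" "y2 \<in> A n"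
          "dist y1 (x0 + s *\<^sub>R x) < e * s / 2" "dist y2 x0 < e * s / 2"
        using e s unfolding closure_approachable
        by (metis half_gt_zero mult_pos_pos)
      then obtain z1 z2 where z: "(z1, y1) \<in> W" "(z2, y2) \<in> W" "norm z1 \<le> n" "norm z2 \<le> n"
        unfolding A_def by blast
      have mem: "((z1 - z2) /\<^sub>R s, (y1 - y2) /\<^sub>R s) \<in> W"
        using subspace_scale[OF W subspace_diff[OF W z(1,2)], of "inverse s"] by simp
      have "norm ((z1 - z2) /\<^sub>R s) \<le> (2 * real n) / s"
        using norm_triangle_ineq4[of z1 z2] z s by (simp add: divide_simps)
      also have "\<dots> = 4 * real n / r * norm x" using False r by (simp add: s_def)
      finally have nz: "norm ((z1 - z2) /\<^sub>R s) \<le> 4 * real n / r * norm x" .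
      have "x - (y1 - y2) /\<^sub>R s = ((y2 - x0) - (y1 - (x0 + s *\<^sub>R x))) /\<^sub>R s"
        using s by (simp add: algebra_simps)
      then have "norm (x - (y1 - y2) /\<^sub>R s) = norm ((y2 - x0) - (y1 - (x0 + s *\<^sub>R x))) / s"
        using s by (simp add: divide_simps)
      also have "\<dots> < (e * s) / s"
        using norm_triangle_ineq4[of "y2 - x0" "y1 - (x0 + s *\<^sub>R x)"] y(3,4) s
        by (intro divide_strict_right_mono) (auto simp: dist_norm)
      finally have "norm (x - (y1 - y2) /\<^sub>R s) < e" using s by simp
      with mem nz show ?thesis by blast
    qed
  qed
qed

text \<open>
  Correcting the error of an approximate preimage again and again, with errors that halve at each
  step, makes the corrections summable. Completeness provides their sum, and closedness of the
  relation makes the sum an exact preimage. Stating this for a relation rather than for a map covers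
  the closed graph theorem, lifting through an operator, and projections along a complement, all
  with the whole space as target.
\<close>
lemma closed_relation_lift:
  fixes W :: "('a::banach \<times> 'b::banach) set"
  assumes W: "subspace W" and "closed W" and surj: "\<And>x. \<exists>z. (z, x) \<in> W"
  shows "\<exists>C. \<forall>x. \<exists>z. (z, x) \<in> W \<and> norm z \<le> C * norm x"
proof -
  obtain K where K: "K \<ge> 0"
    and "\<forall>x. \<forall>e>0. \<exists>z y. (z, y) \<in> W \<and> norm z \<le> K * norm x \<and> norm (x - y) < e"
    using closed_relation_approx[OF W surj] by blast
  then obtain Z Y where ZY: "\<And>x e. e > 0 \<Longrightarrow> (Z x e, Y x e) \<in> W"
      "\<And>x e. e > 0 \<Longrightarrow> norm (Z x e) \<le> K * norm x" "\<And>x e. e > 0 \<Longrightarrow> norm (x - Y x e) < e"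
    by metis
  have "\<exists>z. (z, x) \<in> W \<and> norm z \<le> (2 * K) * norm x" for x
  proof (cases "x = 0")
    case True
    then show ?thesis using subspace_0[OF W] by (intro exI[of _ 0]) (simp add: zero_prod_def)
  next
    case False
    define e where "e k = norm x * (1/2) ^ Suc k" for k
    \<comment> \<open>\<open>u k\<close> is the residual still to be lifted after \<open>k\<close> corrections.\<close>
    define u where "u = rec_nat x (\<lambda>k v. v - Y v (e k))"
    have u0: "u 0 = x" and uS: "u (Suc k) = u k - Y (u k) (e k)" for k by (simp_all add: u_def)
    have e: "e k > 0" for k using False by (simp add: e_def)
    have nu: "norm (u k) \<le> norm x * (1/2) ^ k" for k
    proof (cases k)
      case (Suc j)
      then show ?thesis using ZY(3)[OF e, of "u j" j] by (simp add: uS e_def)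
    qed (simp add: u0)
    define z where "z k = Z (u k) (e k)" for k
    have nz: "norm (z k) \<le> K * norm x * (1/2) ^ k" for k
      using ZY(2)[OF e, of "u k" k] mult_left_mono[OF nu K, of k] by (simp add: z_def mult.assoc)
    have sg: "summable (\<lambda>k. K * norm x * (1/2::real) ^ k)" by (intro summable_mult summable_geometric) simp
    have sz: "summable z" by (rule summable_comparison_test'[OF sg]) (use nz in simp)
    have "norm (suminf z) \<le> (\<Sum>k. K * norm x * (1/2) ^ k)" by (rule norm_suminf_le[OF nz sg])
    also have "\<dots> = K * norm x * 2"
      by (subst suminf_mult) (simp_all add: suminf_geometric summable_geometric)
    finally have bound: "norm (suminf z) \<le> 2 * K * norm x" by simp
    have part: "(\<Sum>k<n. z k, x - u n) \<in> W" for n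
    proof (induction n)
      case 0
      then show ?case using subspace_0[OF W] by (simp add: u0 zero_prod_def)
    next
      case (Suc n)
      then show ?case using subspace_add[OF W Suc ZY(1)[OF e, of "u n" n]]
        by (simp add: uS z_def algebra_simps)
    qed
    have "(\<lambda>n. norm x * (1/2) ^ n) \<longlonglongrightarrow> 0"
      by (intro tendsto_mult_right_zero LIMSEQ_power_zero) simp
    then have "u \<longlonglongrightarrow> 0" by (rule Lim_null_comparison[rotated]) (use nu in simp)
    then have "(\<lambda>n. (\<Sum>k<n. z k, x - u n)) \<longlonglongrightarrow> (suminf z, x - 0)"
      by (intro tendsto_Pair tendsto_diff tendsto_const summable_LIMSEQ[OF sz])
    from closed_sequentially[OF \<open>closed W\<close> _ this] part have "(suminf z, x) \<in> W" by simp
    with bound show ?thesis by blast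
  qed
  then show ?thesis by blast
qed
section \<open>Bounded complex-linear operators\<close>

lemma bounded_clinear_iff:
  "bounded_clinear f \<longleftrightarrow> bounded_linear f \<and> (\<forall>c x. f (c *\<^sub>C x) = c *\<^sub>C f x)"
proof (intro iffI conjI allI)
  assume "bounded_clinear f"
  then interpret bounded_clinear f .
  show "bounded_linear f"
    using add scale[of "complex_of_real _"] bounded
    by (auto intro!: bounded_linear.intro linearI bounded_linear_axioms.intro simp: scaleR_scaleC)
  show "f (c *\<^sub>C x) = c *\<^sub>C f x" for c x by (rule scale)
next
  assume "bounded_linear f \<and> (\<forall>c x. f (c *\<^sub>C x) = c *\<^sub>C f x)"
  then interpret bounded_linear f + A: Vector_Spaces.linear scaleC scaleC f
    by (auto simp: Vector_Spaces.linear_iff bounded_linear.linear linear_add complex_vector.vector_space_axioms)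
  show "bounded_clinear f" by unfold_locales (rule bounded)
qed

lemma bounded_clinear_imp_bounded_linear: "bounded_clinear f \<Longrightarrow> bounded_linear f"
  by (simp add: bounded_clinear_iff)

lemma bounded_clinear_zero: "bounded_clinear (\<lambda>x. 0)"
  by (simp add: bounded_clinear_iff)

lemma bounded_clinear_ident: "bounded_clinear (\<lambda>x. x)"
  by (simp add: bounded_clinear_iff)

lemma bounded_clinear_compose:
  "bounded_clinear f \<Longrightarrow> bounded_clinear g \<Longrightarrow> bounded_clinear (\<lambda>x. f (g x))"
  by (simp add: bounded_clinear_iff bounded_linear_compose)

lemma bounded_clinear_add:
  "bounded_clinear f \<Longrightarrow> bounded_clinear g \<Longrightarrow> bounded_clinear (\<lambda>x. f x + g x)"
  by (simp add: bounded_clinear_iff bounded_linear_add scaleC_add_right)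

lemma bounded_clinear_diff:
  "bounded_clinear f \<Longrightarrow> bounded_clinear g \<Longrightarrow> bounded_clinear (\<lambda>x. f x - g x)"
  by (simp add: bounded_clinear_iff bounded_linear_sub complex_vector.scale_right_diff_distrib)

lemma bounded_clinear_funpow:
  fixes T :: "'a::complex_normed_vector \<Rightarrow> 'a"
  shows "bounded_clinear T \<Longrightarrow> bounded_clinear (T ^^ n)"
proof (induction n)
  case 0
  then show ?case by (simp add: id_def bounded_clinear_ident)
next
  case (Suc n)
  then show ?case using bounded_clinear_compose[of T "T ^^ n"] by (simp add: comp_def)
qed

lemmas bounded_clinear_intros =
  bounded_clinear_zero bounded_clinear_ident bounded_clinear_add bounded_clinear_diff bounded_clinear_funpow

lemma bounded_clinear_simps:
  assumes "bounded_clinear f"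
  shows "f 0 = 0" "f (x + y) = f x + f y" "f (x - y) = f x - f y" "f (c *\<^sub>C x) = c *\<^sub>C f x"
  using assms unfolding bounded_clinear_iff
  by (auto simp: linear_0 linear_add linear_diff bounded_linear.linear)

lemma bounded_clinear_continuous:
  "bounded_clinear f \<Longrightarrow> continuous_on S g \<Longrightarrow> continuous_on S (\<lambda>x. f (g x))"
  by (simp add: bounded_clinear_iff bounded_linear.continuous_on)

lemma csubspace_null_space: "bounded_clinear f \<Longrightarrow> csubspace (null_space f)"
  by (simp add: complex_vector.subspace_def null_space_def bounded_clinear_simps)

lemma csubspace_range: "bounded_clinear f \<Longrightarrow> csubspace (range f)"
  by (auto simp: complex_vector.subspace_def bounded_clinear_simps image_iff)
    (metis bounded_clinear_simps)+

lemma csubspace_imp_subspace: "csubspace M \<Longrightarrow> subspace M"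
  by (simp add: complex_vector.subspace_def subspace_def scaleR_scaleC)

section \<open>Bounded operators from closed relations\<close>

text \<open>
  A preimage \<open>z\<close> of \<open>x\<close> is determined only modulo the preimages of \<open>0\<close>. An operator \<open>H\<close> that kills
  those yields a well-defined and hence linear map of \<open>x\<close>, and it is bounded because \<open>z\<close> may be
  chosen with norm at most a fixed multiple of that of \<open>x\<close>.
\<close>
lemma closed_relation_operator:
  fixes W :: "('a::cbanach \<times> 'b::cbanach) set" and H :: "'a \<Rightarrow> 'c::complex_normed_vector"
  assumes W: "subspace W" "closed W"
    and scale: "\<And>c z x. (z, x) \<in> W \<Longrightarrow> (c *\<^sub>C z, c *\<^sub>C x) \<in> W"
    and surj: "\<And>x. \<exists>z. (z, x) \<in> W"
    and H: "bounded_clinear H" and ker: "\<And>z. (z, 0) \<in> W \<Longrightarrow> H z = 0"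
  shows "\<exists>B. bounded_clinear B \<and> (\<forall>z x. (z, x) \<in> W \<longrightarrow> B x = H z)"
proof -
  obtain C where "\<forall>x. \<exists>z. (z, x) \<in> W \<and> norm z \<le> C * norm x"
    using closed_relation_lift[OF W surj] by blast
  then obtain L where L: "\<And>x. (L x, x) \<in> W" "\<And>x. norm (L x) \<le> C * norm x" by metis
  define B where "B x = H (L x)" for x
  have B: "B x = H z" if "(z, x) \<in> W" for z x
    using ker[of "L x - z"] subspace_diff[OF W(1) L(1)[of x] that]
    by (simp add: B_def bounded_clinear_simps[OF H])
  obtain K where K: "K \<ge> 0" "\<And>z. norm (H z) \<le> norm z * K"
    using bounded_linear.nonneg_bounded[OF bounded_clinear_imp_bounded_linear[OF H]] by blast
  have Bc: "B (c *\<^sub>C x) = c *\<^sub>C B x" for c x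
    using B[OF scale[OF L(1)]] by (simp add: B_def bounded_clinear_simps[OF H])
  have "bounded_linear B"
  proof (rule bounded_linear_intro[where K = "C * K"])
    show "B (x + y) = B x + B y" for x y
      using B[of "L x + L y" "x + y"] subspace_add[OF W(1) L(1)[of x] L(1)[of y]]
      by (simp add: B_def bounded_clinear_simps[OF H])
    show "B (r *\<^sub>R x) = r *\<^sub>R B x" for r x by (simp add: scaleR_scaleC Bc)
    show "norm (B x) \<le> norm x * (C * K)" for x
    proof -
      have "norm (B x) \<le> norm (L x) * K" unfolding B_def by (rule K)
      also have "\<dots> \<le> C * norm x * K" using L(2) K(1) by (rule mult_right_mono)
      finally show ?thesis by (simp add: mult_ac)
    qed
  qed
  with Bc B show ?thesis unfolding bounded_clinear_iff by blast
qed

text \<open>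
  A variant of Douglas' factorization lemma: \<open>G z = A x\<close> is a closed relation between \<open>z\<close> and \<open>x\<close>
  even when the range of \<open>G\<close> is not closed.
\<close>
lemma factor_through_range:
  fixes G :: "'a::cbanach \<Rightarrow> 'd::complex_normed_vector" and A :: "'b::cbanach \<Rightarrow> 'd"
    and H :: "'a \<Rightarrow> 'c::complex_normed_vector"
  assumes G: "bounded_clinear G" and A: "bounded_clinear A" and H: "bounded_clinear H"
    and range: "range A \<subseteq> range G" and ker: "\<And>z. G z = 0 \<Longrightarrow> H z = 0"
  shows "\<exists>B. bounded_clinear B \<and> (\<forall>z x. G z = A x \<longrightarrow> B x = H z)"
proof -
  let ?W = "{(z, x). G z = A x}"
  note simps = bounded_clinear_simps[OF G] bounded_clinear_simps[OF A]
  have "\<exists>B. bounded_clinear B \<and> (\<forall>z x. (z, x) \<in> ?W \<longrightarrow> B x = H z)"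
  proof (rule closed_relation_operator[OF _ _ _ _ H])
    show "subspace ?W" by (auto simp: subspace_def zero_prod_def simps scaleR_scaleC)
    show "closed ?W" unfolding case_prod_beta
      by (intro closed_Collect_eq bounded_clinear_continuous[OF G] bounded_clinear_continuous[OF A]
          continuous_intros)
    show "\<exists>z. (z, x) \<in> ?W" for x
    proof -
      have "A x \<in> range G" using range by blast
      then show ?thesis by (auto simp: image_iff)
    qed
  qed (use ker in \<open>auto simp: simps\<close>)
  then show ?thesis by simp
qed

section \<open>Complemented subspaces and bounded projections\<close>

definition bounded_projection :: "('a::complex_normed_vector \<Rightarrow> 'a) \<Rightarrow> 'a set \<Rightarrow> bool"
  where "bounded_projection P M \<longleftrightarrow>
    bounded_clinear P \<and> range P \<subseteq> M \<and> (\<forall>x\<in>M. P x = x)"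

text \<open>
  The projection along a closed complement \<open>N\<close> relates \<open>x\<close> to \<open>z \<in> M\<close> with \<open>x - z \<in> N\<close>. This
  relation is closed, and \<open>M \<inter> N = {0}\<close> makes it single-valued.
\<close>
lemma top_complemented_imp_projection:
  fixes M :: "'a::cbanach set"
  assumes "top_complemented M"
  shows "\<exists>P. bounded_projection P M"
proof -
  obtain N where M: "csubspace M" "closed M" and N: "csubspace N" "closed N"
    and MN: "M \<inter> N = {0}" "{x + y | x y. x \<in> M \<and> y \<in> N} = UNIV"
    using assms unfolding top_complemented_def by blast
  let ?W = "{(z, x). z \<in> M \<and> x - z \<in> N}"
  have "\<exists>P. bounded_clinear P \<and> (\<forall>z x. (z, x) \<in> ?W \<longrightarrow> P x = z)"
  proof (rule closed_relation_operator[OF _ _ _ _ bounded_clinear_ident])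
    have W: "?W = (M \<times> UNIV) \<inter> (\<lambda>p. snd p - fst p) -` N" by auto
    have "linear (\<lambda>p::'a \<times> 'a. snd p - fst p)"
      by (intro bounded_linear.linear bounded_linear_intros)
    then show "subspace ?W" unfolding W using M(1) N(1)
      by (intro subspace_inter subspace_Times linear_subspace_vimage csubspace_imp_subspace) auto
    show "closed ?W" unfolding W using M(2) N(2)
      by (intro closed_Int closed_Times closed_vimage continuous_intros) auto
    show "(c *\<^sub>C z, c *\<^sub>C x) \<in> ?W" if "(z, x) \<in> ?W" for c z x
      using that M(1) N(1)
      by (auto simp: complex_vector.subspace_scale simp flip: complex_vector.scale_right_diff_distrib)
    show "\<exists>z. (z, x) \<in> ?W" for x
    proof -
      obtain y z where "x = y + z" "y \<in> M" "z \<in> N" using MN(2) by blast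
      then show ?thesis by (intro exI[of _ y]) simp
    qed
    show "z = 0" if "(z, 0) \<in> ?W" for z
      using that MN(1) complex_vector.subspace_neg[OF N(1), of "- z"] by auto
  qed
  then obtain P where P: "bounded_clinear P" "\<And>z x. z \<in> M \<Longrightarrow> x - z \<in> N \<Longrightarrow> P x = z" by auto
  have "P x \<in> M" for x
  proof -
    obtain y z where "x = y + z" "y \<in> M" "z \<in> N" using MN(2) by blast
    then show ?thesis using P(2)[of y x] by simp
  qed
  moreover have "P x = x" if "x \<in> M" for x
    using P(2)[OF that, of x] complex_vector.subspace_0[OF N(1)] by simp
  ultimately show ?thesis using P(1) unfolding bounded_projection_def by blast
qed

lemma projection_imp_top_complemented:
  assumes "bounded_projection P M"
  shows "top_complemented M"
proof -
  have P: "bounded_clinear P" "range P \<subseteq> M" "\<And>x. x \<in> M \<Longrightarrow> P x = x"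
    using assms unfolding bounded_projection_def by auto
  have M: "M = null_space (\<lambda>x. x - P x)"
    using P(2,3) by (force simp: null_space_def)
  have cl: "closed (null_space f)" if "bounded_clinear f" for f :: "'a \<Rightarrow> 'a"
    unfolding null_space_def
    by (intro closed_Collect_eq bounded_clinear_continuous[OF that] continuous_intros)
  have I_P: "bounded_clinear (\<lambda>x. x - P x)" by (intro bounded_clinear_intros P)
  have "\<exists>u v. x = u + v \<and> u \<in> M \<and> v \<in> null_space P" for x
    using P by (intro exI[of _ "P x"] exI[of _ "x - P x"])
      (auto simp: null_space_def bounded_clinear_simps(3)[OF P(1)] range_subsetD)
  moreover have "M \<inter> null_space P = {0}"
    using P(3) bounded_clinear_simps(1)[OF P(1)] P(2) by (force simp: null_space_def)
  moreover have "csubspace M" "closed M"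
    unfolding M using csubspace_null_space[OF I_P] cl[OF I_P] by auto
  ultimately show ?thesis
    unfolding top_complemented_def using csubspace_null_space[OF P(1)] cl[OF P(1)] by blast
qed

section \<open>Lifting along the stable range\<close>

lemma descent_finiteE:
  assumes "descent T < \<infinity>"
  obtains q where "descent T = enat q" "range (T ^^ Suc q) = range (T ^^ q)"
proof -
  have "\<exists>n. range (T ^^ n) = range (T ^^ (n + 1))"
    using assms unfolding descent_def by (auto split: if_splits)
  with LeastI_ex[OF this] that show thesis unfolding descent_def by simp
qed

lemma range_funpow_stable:
  fixes T :: "'a \<Rightarrow> 'a"
  assumes "range (T ^^ Suc q) = range (T ^^ q)" "q \<le> n"
  shows "range (T ^^ n) = range (T ^^ q)"
  using assms(2)
proof (induction n rule: dec_induct)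
  case (step n)
  have "range (T ^^ Suc n) = T ` range (T ^^ n)" by (auto simp: image_comp)
  also have "\<dots> = range (T ^^ Suc q)" using step by (auto simp: image_comp)
  finally show ?case using assms(1) by simp
qed simp

text \<open>
  To solve \<open>T (B x) = A x\<close> within the range of \<open>T ^^ q\<close>, write \<open>A x = (T ^^ (q + 1)) z\<close>. The vector
  \<open>(T ^^ q) z\<close> is a solution, determined modulo the subspace onto which \<open>P\<close> projects, and removing
  its \<open>P\<close>-component makes it unique. The conclusion that \<open>B\<close> vanishes wherever \<open>A\<close> does
  later ensures that a lift of \<open>T ^^ n\<close> vanishes on the kernel of \<open>T ^^ n\<close>.
\<close>
lemma lift_along_range:
  fixes T :: "'a::cbanach \<Rightarrow> 'a" and A :: "'b::cbanach \<Rightarrow> 'a"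
  assumes T: "bounded_clinear T" and stable: "range (T ^^ Suc q) = range (T ^^ q)"
    and P: "bounded_projection P (null_space T \<inter> range (T ^^ q))"
    and A: "bounded_clinear A" "range A \<subseteq> range (T ^^ q)"
  shows "\<exists>B. bounded_clinear B \<and> range B \<subseteq> range (T ^^ q) \<and> (\<forall>x. T (B x) = A x)
    \<and> (\<forall>x. A x = 0 \<longrightarrow> B x = 0)"
proof -
  have Pl: "bounded_clinear P" and PR: "\<And>x. P x \<in> range (T ^^ q)" and TP: "\<And>x. T (P x) = 0"
    and Pid: "\<And>x. T x = 0 \<Longrightarrow> x \<in> range (T ^^ q) \<Longrightarrow> P x = x"
    using P unfolding bounded_projection_def null_space_def by auto
  note Tq = bounded_clinear_funpow[OF T]
  let ?H = "\<lambda>z. (T ^^ q) z - P ((T ^^ q) z)"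
  have "\<exists>B. bounded_clinear B \<and> (\<forall>z x. (T ^^ Suc q) z = A x \<longrightarrow> B x = ?H z)"
  proof (rule factor_through_range)
    show "bounded_clinear ?H"
      by (intro bounded_clinear_diff bounded_clinear_compose[OF Pl] Tq)
    show "range A \<subseteq> range (T ^^ Suc q)" unfolding stable by (rule A(2))
    show "?H z = 0" if "(T ^^ Suc q) z = 0" for z
      using Pid[of "(T ^^ q) z"] that by simp
  qed (rule bounded_clinear_funpow[OF T] A(1))+
  then obtain B where B: "bounded_clinear B" "\<And>z x. (T ^^ Suc q) z = A x \<Longrightarrow> B x = ?H z"
    by blast
  have "B x \<in> range (T ^^ q) \<and> T (B x) = A x" for x
  proof -
    obtain z where z: "(T ^^ Suc q) z = A x" using A(2) stable by (metis rangeE range_subsetD)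
    have "?H z \<in> range (T ^^ q)"
      by (intro complex_vector.subspace_diff[OF csubspace_range[OF Tq]] PR rangeI)
    then show ?thesis using B(2)[OF z] z by (simp add: bounded_clinear_simps[OF T] TP)
  qed
  moreover have "B x = 0" if "A x = 0" for x
    using B(2)[of 0 x] that
    by (simp add: bounded_clinear_simps(1)[OF Tq] bounded_clinear_simps(1)[OF T] bounded_clinear_simps(1)[OF Pl])
  ultimately show ?thesis using B(1) by blast
qed

lemma lift_along_range_funpow:
  fixes T :: "'a::cbanach \<Rightarrow> 'a" and A :: "'b::cbanach \<Rightarrow> 'a"
  assumes T: "bounded_clinear T" and stable: "range (T ^^ Suc q) = range (T ^^ q)"
    and P: "bounded_projection P (null_space T \<inter> range (T ^^ q))"
    and A: "bounded_clinear A" "range A \<subseteq> range (T ^^ q)"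
  shows "\<exists>B. bounded_clinear B \<and> range B \<subseteq> range (T ^^ q) \<and> (\<forall>x. (T ^^ n) (B x) = A x)
    \<and> (\<forall>x. A x = 0 \<longrightarrow> B x = 0)"
proof (induction n)
  case 0
  then show ?case using A by auto
next
  case (Suc n)
  then obtain B where B: "bounded_clinear B" "range B \<subseteq> range (T ^^ q)"
    "\<forall>x. (T ^^ n) (B x) = A x" "\<forall>x. A x = 0 \<longrightarrow> B x = 0" by blast
  obtain B' where "bounded_clinear B'" "range B' \<subseteq> range (T ^^ q)"
    "\<forall>x. T (B' x) = B x" "\<forall>x. B x = 0 \<longrightarrow> B' x = 0"
    using lift_along_range[OF T stable P B(1,2)] by blast
  with B show ?case by (intro exI[of _ B']) (simp add: funpow_swap1)
qed

text \<open>
  Induction step: let \<open>Q\<close> project onto the kernel of \<open>T ^^ n\<close> in the stable range, and lift \<open>Q \<circ> T\<close>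
  to \<open>B\<close>, so that \<open>T \<circ> B = Q \<circ> T\<close>. If \<open>x\<close> in the stable range satisfies \<open>(T ^^ (n + 1)) x = 0\<close>, then
  \<open>Q\<close> fixes \<open>T x\<close>, so \<open>x - B x\<close> lies in the kernel of \<open>T\<close>, where \<open>P\<close> recovers it. Therefore
  \<open>B + P (I - B)\<close> is a projection for \<open>n + 1\<close>.
\<close>
lemma projection_null_funpow_range:
  fixes T :: "'a::cbanach \<Rightarrow> 'a"
  assumes T: "bounded_clinear T" and stable: "range (T ^^ Suc q) = range (T ^^ q)"
    and P: "bounded_projection P (null_space T \<inter> range (T ^^ q))"
  shows "\<exists>Q. bounded_projection Q (null_space (T ^^ n) \<inter> range (T ^^ q))"
proof (induction n)
  case 0
  have "0 \<in> range (T ^^ q)"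
    by (rule complex_vector.subspace_0[OF csubspace_range[OF bounded_clinear_funpow[OF T]]])
  then show ?case
    by (intro exI[of _ "\<lambda>x. 0"])
      (auto simp: bounded_projection_def null_space_def bounded_clinear_zero)
next
  case (Suc n)
  let ?R = "range (T ^^ q)"
  obtain Q where Q: "bounded_clinear Q" "range Q \<subseteq> ?R" "\<And>x. (T ^^ n) (Q x) = 0"
    "\<And>x. (T ^^ n) x = 0 \<Longrightarrow> x \<in> ?R \<Longrightarrow> Q x = x"
    using Suc unfolding bounded_projection_def null_space_def by blast
  have P': "bounded_clinear P" "\<And>x. P x \<in> ?R" "\<And>x. T (P x) = 0"
    "\<And>x. T x = 0 \<Longrightarrow> x \<in> ?R \<Longrightarrow> P x = x"
    using P unfolding bounded_projection_def null_space_def by auto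
  obtain B where B: "bounded_clinear B" "range B \<subseteq> ?R" "\<And>x. T (B x) = Q (T x)"
    using lift_along_range[OF T stable P bounded_clinear_compose[OF Q(1) T]] Q(2) by blast
  note R = csubspace_range[OF bounded_clinear_funpow[OF T], of q]
  note Tn = bounded_clinear_simps[OF bounded_clinear_funpow[OF T, of n]]
  let ?Q = "\<lambda>x. B x + P (x - B x)"
  have "(T ^^ Suc n) (?Q x) = 0" for x
    by (simp add: funpow_swap1 bounded_clinear_simps[OF T] P' B Q Tn)
  moreover have "?Q x \<in> ?R" for x
    using B(2) P'(2) by (intro complex_vector.subspace_add[OF R]) auto
  moreover have "?Q x = x" if x: "(T ^^ Suc n) x = 0" "x \<in> ?R" for x
  proof -
    have "T x \<in> ?R" using x(2) stable by auto
    then have "T (B x) = T x" using x(1) by (simp add: B(3) Q(4) funpow_swap1)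
    moreover have "x - B x \<in> ?R" using B(2) x(2) by (intro complex_vector.subspace_diff[OF R]) auto
    ultimately have "P (x - B x) = x - B x" using P'(4) by (simp add: bounded_clinear_simps[OF T])
    then show ?thesis by simp
  qed
  moreover have "bounded_clinear ?Q" 
    by (intro bounded_clinear_add bounded_clinear_diff bounded_clinear_ident B(1)
        bounded_clinear_compose[OF P'(1)])
  ultimately have "bounded_projection ?Q (null_space (T ^^ Suc n) \<inter> ?R)"
    unfolding bounded_projection_def null_space_def by auto
  then show ?case by (rule exI[of _ ?Q])
qed

section \<open>The two implications\<close>

lemma right_Drazin_imp_complemented:
  fixes T :: "'a::cbanach \<Rightarrow> 'a"
  assumes T: "bounded_clinear T" and stable: "range (T ^^ Suc q) = range (T ^^ q)"
    and compl: "top_complemented (null_space T \<inter> range (T ^^ q))" and n: "q \<le> n"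
  shows "top_complemented (null_space (T ^^ n))" "top_complemented (range (T ^^ n))"
proof -
  let ?R = "range (T ^^ q)"
  obtain P where P: "bounded_projection P (null_space T \<inter> ?R)"
    using top_complemented_imp_projection[OF compl] by blast
  have Rn: "range (T ^^ n) = ?R" by (rule range_funpow_stable[OF stable n])
  note Tn = bounded_clinear_funpow[OF T, of n]
  note Tns = bounded_clinear_simps[OF Tn]
  obtain E where E: "bounded_clinear E" "range E \<subseteq> ?R" "\<And>x. (T ^^ n) (E x) = (T ^^ n) x"
    "\<And>x. (T ^^ n) x = 0 \<Longrightarrow> E x = 0"
    using lift_along_range_funpow[OF T stable P Tn, of n] Rn by auto
  have I_E: "bounded_clinear (\<lambda>x. x - E x)" by (intro bounded_clinear_intros E(1))
  have "bounded_projection (\<lambda>x. x - E x) (null_space (T ^^ n))"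
    using I_E E by (auto simp: bounded_projection_def null_space_def Tns)
  then show "top_complemented (null_space (T ^^ n))" by (rule projection_imp_top_complemented)
  obtain Q where Q: "bounded_clinear Q" "\<And>x. Q x \<in> ?R"
    "\<And>x. (T ^^ n) x = 0 \<Longrightarrow> x \<in> ?R \<Longrightarrow> Q x = x"
    using projection_null_funpow_range[OF T stable P, of n]
    unfolding bounded_projection_def null_space_def by blast
  note R = csubspace_range[OF bounded_clinear_funpow[OF T], of q]
  \<comment> \<open>For \<open>x\<close> in the stable range, \<open>x - E x\<close> lies in that range and in the kernel of \<open>T ^^ n\<close>.\<close>
  let ?F = "\<lambda>x. E x + Q (x - E x)"
  have "?F x \<in> ?R" for x using E(2) Q(2) by (intro complex_vector.subspace_add[OF R]) auto
  moreover have "?F x = x" if "x \<in> ?R" for x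
  proof -
    have "x - E x \<in> ?R" using E(2) that by (intro complex_vector.subspace_diff[OF R]) auto
    then have "Q (x - E x) = x - E x" using E(3) by (intro Q(3)) (simp add: Tns)
    then show ?thesis by simp
  qed
  moreover have "bounded_clinear ?F" by (intro bounded_clinear_add E(1) bounded_clinear_compose[OF Q(1) I_E])
  ultimately have "bounded_projection ?F ?R" unfolding bounded_projection_def by blast
  then show "top_complemented (range (T ^^ n))" unfolding Rn by (rule projection_imp_top_complemented)
qed

text \<open>
  The complement of the kernel of \<open>T ^^ (n + 1)\<close> provides a canonical solution \<open>z - P z\<close> of
  \<open>(T ^^ (n + 1)) z = T (F x)\<close>. Its image \<open>B x\<close> under \<open>T ^^ n\<close> lies in the range of \<open>T ^^ n\<close> and differs
  from \<open>F x\<close> by an element of the kernel of \<open>T\<close>; taking this difference is the wanted projection.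
\<close>
lemma complemented_imp_right_Drazin:
  fixes T :: "'a::cbanach \<Rightarrow> 'a"
  assumes T: "bounded_clinear T" and stable: "range (T ^^ Suc n) = range (T ^^ n)"
    and N: "top_complemented (null_space (T ^^ Suc n))" and R: "top_complemented (range (T ^^ n))"
  shows "top_complemented (null_space T \<inter> range (T ^^ n))"
proof -
  let ?R = "range (T ^^ n)"
  obtain P where P: "bounded_clinear P" "\<And>x. (T ^^ Suc n) (P x) = 0"
    "\<And>x. (T ^^ Suc n) x = 0 \<Longrightarrow> P x = x"
    using top_complemented_imp_projection[OF N] unfolding bounded_projection_def null_space_def by blast
  obtain F where F: "bounded_clinear F" "\<And>x. F x \<in> ?R" "\<And>x. x \<in> ?R \<Longrightarrow> F x = x"
    using top_complemented_imp_projection[OF R] unfolding bounded_projection_def by blast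
  have lift: "\<exists>z. (T ^^ Suc n) z = T (F x)" for x
    using F(2)[of x] by auto
  have "\<exists>B. bounded_clinear B \<and> (\<forall>z x. (T ^^ Suc n) z = T (F x) \<longrightarrow> B x = (T ^^ n) (z - P z))"
  proof (rule factor_through_range)
    show "range (\<lambda>x. T (F x)) \<subseteq> range (T ^^ Suc n)" using lift by (metis image_subsetI rangeI)
    show "(T ^^ n) (z - P z) = 0" if "(T ^^ Suc n) z = 0" for z
      using P(3)[OF that] by (simp add: bounded_clinear_simps(1)[OF bounded_clinear_funpow[OF T]])
    show "bounded_clinear (\<lambda>x. T (F x))" by (rule bounded_clinear_compose[OF T F(1)])
    show "bounded_clinear (\<lambda>z. (T ^^ n) (z - P z))"
      by (intro bounded_clinear_compose[OF bounded_clinear_funpow[OF T]] bounded_clinear_intros P(1))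
  qed (rule bounded_clinear_funpow[OF T])
  then obtain B where B: "bounded_clinear B"
    "\<And>z x. (T ^^ Suc n) z = T (F x) \<Longrightarrow> B x = (T ^^ n) (z - P z)" by blast
  have BR: "B x \<in> ?R" and TB: "T (B x) = T (F x)" for x
  proof -
    obtain z where z: "(T ^^ Suc n) z = T (F x)" using lift by blast
    show "B x \<in> ?R" using B(2)[OF z] by simp
    have "T (B x) = (T ^^ Suc n) (z - P z)" using B(2)[OF z] by simp
    also have "\<dots> = T (F x)"
      using P(2) z by (simp only: bounded_clinear_simps(3)[OF bounded_clinear_funpow[OF T]]) simp
    finally show "T (B x) = T (F x)" .
  qed
  have "B x = 0" if "T x = 0" "x \<in> ?R" for x
    using B(2)[of 0 x] that F(3)[of x]
    by (simp add: bounded_clinear_simps(1)[OF bounded_clinear_funpow[OF T]]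
        bounded_clinear_simps(1)[OF T] bounded_clinear_simps(1)[OF P(1)])
  moreover have "F x - B x \<in> ?R" for x
    by (intro complex_vector.subspace_diff[OF csubspace_range[OF bounded_clinear_funpow[OF T]]] F(2) BR)
  moreover have "T (F x - B x) = 0" for x by (simp add: bounded_clinear_simps[OF T] TB)
  ultimately have "bounded_projection (\<lambda>x. F x - B x) (null_space T \<inter> ?R)"
    using F B(1) by (auto simp: bounded_projection_def null_space_def intro: bounded_clinear_diff)
  then show ?thesis by (rule projection_imp_top_complemented)
qed

theorem theorem3p2:
  fixes T :: "'a::cbanach \<Rightarrow> 'a"
  assumes "infinite_dimensional TYPE('a)"
    and "bounded_clinear T"
  shows "(right_Drazin_invertible T \<longleftrightarrow>
      descent T < \<infinity> \<and>
      (\<forall>n. descent T \<le> enat n \<longrightarrow>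
        top_complemented (null_space (T ^^ n)) \<and> top_complemented (range (T ^^ n))))
    \<and> (right_Drazin_invertible T \<longleftrightarrow>
      descent T < \<infinity> \<and>
      (\<exists>n. descent T \<le> enat n \<and>
        top_complemented (null_space (T ^^ (n + 1))) \<and> top_complemented (range (T ^^ n))))"
    (is "(?i \<longleftrightarrow> ?ii) \<and> (?i \<longleftrightarrow> ?iii)")
proof -
  note T = assms(2)
  have "?i \<Longrightarrow> ?ii"
  proof -
    assume ?i
    then obtain q where q: "descent T = enat q" "top_complemented (null_space T \<inter> range (T ^^ q))"
      unfolding right_Drazin_invertible_def by blast
    moreover from q(1) have "range (T ^^ Suc q) = range (T ^^ q)"
      by (metis descent_finiteE enat.inject enat_ord_simps(4) enat.distinct(1))
    ultimately show ?ii using right_Drazin_imp_complemented[OF T] by auto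
  qed
  moreover have "?ii \<Longrightarrow> ?iii"
  proof -
    assume ii: ?ii
    then obtain q where q: "descent T = enat q" using descent_finiteE by blast
    with ii show ?iii by (auto intro!: exI[of _ q] simp del: funpow.simps)
  qed
  moreover have "?iii \<Longrightarrow> ?i"
  proof -
    assume iii: ?iii
    then obtain q where q: "descent T = enat q" "range (T ^^ Suc q) = range (T ^^ q)"
      using descent_finiteE by blast
    from iii q(1) obtain n where n: "q \<le> n" "top_complemented (null_space (T ^^ Suc n))"
      "top_complemented (range (T ^^ n))" by auto
    note R = range_funpow_stable[OF q(2)]
    have "range (T ^^ Suc n) = range (T ^^ n)" using R[of n] R[of "Suc n"] n(1) by simp
    from complemented_imp_right_Drazin[OF T this n(2,3)] show ?i
      unfolding right_Drazin_invertible_def q(1) R[OF n(1)] by blast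
  qed
  ultimately show ?thesis by blast
qed

end
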